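(* Let $A,B$ be finite sets with Jaccard similarity $\rho=|A\cap B|/|A\cup B|$, and let $\hat n_2=\hat\rho\cdot\hat u$ be the Scheme-2 estimator of $n=|A\cap B|$. Then $$\frac{\hat n_2}{n}\ \to\ \mathcal{N}\!\left(1,\ \frac{1}{m\rho}\right),$$ where $m$ is the number of storage units.
   Context: Notation: $n=|A\cap B|$, $u=|A\cup B|$, $\rho=n/u$. Estimate of $\rho$: $m$ hash functions $h_1,\dots,h_m$ map elements into $(0,1)$, the hash values being viewed as uniformly distributed random variables; $x_A^j=\max_{e\in A}h_j(e)$, $x_B^j=\max_{e\in B}h_j(e)$, and $\hat\rho=\frac1m\sum_{j=1}^m \mathbf{1}\{x_A^j=x_B^j\}$. Estimate of $u$: $\hat u$ is the estimate of $|A\cup B|$ given by the HyperLogLog cardinality estimation algorithm with $m$ storage units. For a stream of elements (with repetitions) this algorithm keeps $m$ registers $C_1,\dots,C_m$, initially $0$; each element $x$ is assigned by a hash function $g_2$ to a register $j=g_2(x)$, and $C_j$ is replaced by the maximum of $C_j$ and the position of the leftmost 1-bit of the hashed value $g_1(x)\in(0,1)$. The estimate is $\gamma_m m^2\big(\sum_{j=1}^m 2^{-C_j}\big)^{-1}$ with $\gamma_m=\big(m\int_0^\infty(\log_2\frac{2+v}{1+v})^m\,dv\big)^{-1}$. Its performance is taken to be $\hat u\to\mathcal{N}(u,u^2/m)$. $T\to\mathcal{N}(\mu,\sigma^2)$ means that $T$ is asymptotically (as $m\to\infty$) normally distributed with mean $\mu$ and variance $\sigma^2$. *)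

theory Defs
  imports "HOL-Probability.Probability"
begin

definition jaccard :: "'e set \<Rightarrow> 'e set \<Rightarrow> real" where
  "jaccard A B = real (card (A \<inter> B)) / real (card (A \<union> B))"

text \<open>A hash function applied to a finite nonempty set yields the sketch \<open>Max (h j ` A)\<close>; the
  estimator of the Jaccard similarity is the fraction of the \<open>m\<close> sketches on which the two sets
  agree.\<close>

definition jaccard_estimate :: "nat \<Rightarrow> (nat \<Rightarrow> 'e \<Rightarrow> real) \<Rightarrow> 'e set \<Rightarrow> 'e set \<Rightarrow> real" where
  "jaccard_estimate m h A B =
     (1 / real m) * (\<Sum>j=1..m. of_bool (Max (h j ` A) = Max (h j ` B)))"

text \<open>For \<open>y \<in> {0<..<1}\<close> the \<open>k\<close>-th binary digit of \<open>y\<close> after the point (counted from 1) is the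
  parity of \<open>\<lfloor>2 ^ k * y\<rfloor>\<close>; dyadic rationals are read with their terminating expansion.\<close>

definition leftmost_one_bit :: "real \<Rightarrow> nat" where
  "leftmost_one_bit y = (LEAST k. 1 \<le> k \<and> odd \<lfloor>2 ^ k * y\<rfloor>)"

definition hll_update ::
  "('e \<Rightarrow> real) \<Rightarrow> ('e \<Rightarrow> nat) \<Rightarrow> 'e \<Rightarrow> (nat \<Rightarrow> nat) \<Rightarrow> (nat \<Rightarrow> nat)" where
  "hll_update g1 g2 x C = C(g2 x := max (C (g2 x)) (leftmost_one_bit (g1 x)))"

definition hll_registers :: "('e \<Rightarrow> real) \<Rightarrow> ('e \<Rightarrow> nat) \<Rightarrow> 'e list \<Rightarrow> nat \<Rightarrow> nat" where
  "hll_registers g1 g2 xs = fold (hll_update g1 g2) xs (\<lambda>_. 0)"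

text \<open>For \<open>m \<ge> 2\<close> the integrand is \<open>O(v powr - m)\<close> and the integral is finite; for \<open>m \<le> 1\<close> it diverges
  and the constant takes the irrelevant value 0.\<close>

definition hll_gamma :: "nat \<Rightarrow> real" where
  "hll_gamma m = inverse (real m * (LBINT v:{0..}. (log 2 ((2 + v) / (1 + v))) ^ m))"

definition hll_estimate :: "nat \<Rightarrow> ('e \<Rightarrow> real) \<Rightarrow> ('e \<Rightarrow> nat) \<Rightarrow> 'e list \<Rightarrow> real" where
  "hll_estimate m g1 g2 xs =
     hll_gamma m * (real m)\<^sup>2 * inverse (\<Sum>j=1..m. 2 powr (- real (hll_registers g1 g2 xs j)))"

definition scheme2_estimate ::
  "nat \<Rightarrow> (nat \<Rightarrow> 'e \<Rightarrow> real) \<Rightarrow> ('e \<Rightarrow> real) \<Rightarrow> ('e \<Rightarrow> nat) \<Rightarrow> 'e set \<Rightarrow> 'e set \<Rightarrow> 'e list \<Rightarrow> real" where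
  "scheme2_estimate m h g1 g2 A B xs = jaccard_estimate m h A B * hll_estimate m g1 g2 xs"

text \<open>\<open>T m\<close> is asymptotically normal with mean \<open>\<mu> m\<close> and variance \<open>v m\<close> as \<open>m \<rightarrow> \<infinity>\<close>. Since \<open>v m\<close> may tend to 0,
  this means that the standardized variables converge in distribution to the standard normal law.\<close>

definition asymptotically_normal ::
  "'w measure \<Rightarrow> (nat \<Rightarrow> 'w \<Rightarrow> real) \<Rightarrow> (nat \<Rightarrow> real) \<Rightarrow> (nat \<Rightarrow> real) \<Rightarrow> bool" where
  "asymptotically_normal M T \<mu> v \<longleftrightarrow>
     weak_conv_m (\<lambda>m. distr M borel (\<lambda>\<omega>. (T m \<omega> - \<mu> m) / sqrt (v m))) std_normal_distribution"

end

theory Submission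
  imports Defs
begin

text \<open>With \<open>D = (\<Sum>j. 1{x\<^sub>A\<^sup>j = x\<^sub>B\<^sup>j} - \<rho>) / sqrt (m \<rho>)\<close> and \<open>Y\<close> the standardized HyperLogLog
  estimate, the standardized estimator is exactly \<open>D + sqrt \<rho> * Y + (D / sqrt m) * Y\<close>. By the central
  limit theorem for the indicators, \<open>D\<close> is asymptotically \<open>N(0, 1 - \<rho>)\<close>; as \<open>D\<close> and \<open>Y\<close> are independent,
  their characteristic functions multiply and \<open>(1 - \<rho>) + \<rho> = 1\<close>. The last summand vanishes in
  probability, since \<open>D / sqrt m\<close> does (Hoeffding) and \<open>Y\<close> is tight.

  That two sketches agree with probability \<open>\<rho>\<close> comes from the events that \<open>e\<close> is the strict maximizer
  of the hash function on \<open>A \<union> B\<close>: each has probability \<open>1 / |A \<union> B|\<close>, so together they have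
  probability 1 and ties are negligible.\<close>

section \<open>Measurability of the HyperLogLog estimate, and independence through
  sigma-algebras\<close>

lemma measurable_leftmost_one_bit [measurable]:
  "leftmost_one_bit \<in> borel \<rightarrow>\<^sub>M count_space UNIV"
  unfolding leftmost_one_bit_def by measurable

lemma hll_registers_snoc:
  "hll_registers g1 g2 (xs @ [x]) j =
     (if g2 x = j then max (hll_registers g1 g2 xs j) (leftmost_one_bit (g1 x))
      else hll_registers g1 g2 xs j)"
  by (simp add: hll_registers_def hll_update_def)

text \<open>The space \<open>N\<close> is arbitrary because the fact serves both for
  \<open>M\<close> and for the sub-sigma-algebra generated by \<open>g1\<close> and
  \<open>g2\<close>. The induction is from the end of the list, since \<open>fold\<close> applies
  the last stream element last.\<close>

lemma measurable_hll_registers: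
  assumes "\<And>e. e \<in> set xs \<Longrightarrow> g1 e \<in> borel_measurable N"
    and "\<And>e. e \<in> set xs \<Longrightarrow> g2 e \<in> N \<rightarrow>\<^sub>M count_space UNIV"
  shows "(\<lambda>\<omega>. hll_registers (\<lambda>e. g1 e \<omega>) (\<lambda>e. g2 e \<omega>) xs j) \<in> N \<rightarrow>\<^sub>M count_space UNIV"
  using assms
proof (induction xs rule: rev_induct)
  case Nil
  then show ?case by (simp add: hll_registers_def)
next
  case (snoc x xs)
  then have [measurable]: "g1 x \<in> borel_measurable N" "g2 x \<in> N \<rightarrow>\<^sub>M count_space UNIV"
    "(\<lambda>\<omega>. hll_registers (\<lambda>e. g1 e \<omega>) (\<lambda>e. g2 e \<omega>) xs j) \<in> N \<rightarrow>\<^sub>M count_space UNIV"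
    by auto
  show ?case unfolding hll_registers_snoc by measurable
qed

lemma measurable_hll_estimate:
  assumes "\<And>e. e \<in> set xs \<Longrightarrow> g1 e \<in> borel_measurable N"
    and "\<And>e. e \<in> set xs \<Longrightarrow> g2 e \<in> N \<rightarrow>\<^sub>M count_space UNIV"
  shows "(\<lambda>\<omega>. hll_estimate m (\<lambda>e. g1 e \<omega>) (\<lambda>e. g2 e \<omega>) xs) \<in> borel_measurable N"
proof -
  note [measurable] = measurable_hll_registers[OF assms]
  show ?thesis unfolding hll_estimate_def by measurable
qed

text \<open>Preimages under \<open>X\<close> and \<open>Y\<close> generate sigma-algebras contained
  in \<open>sets N1\<close> and \<open>sets N2\<close>, and independence is inherited by smaller
  families. This carries the independence of the two groups of hash functions over to statistics
  computed from them.\<close>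

lemma (in prob_space) indep_var_if_indep_set:
  assumes ind: "indep_set (sets N1) (sets N2)"
    and space: "space N1 = space M" "space N2 = space M"
    and X: "X \<in> N1 \<rightarrow>\<^sub>M S" and Y: "Y \<in> N2 \<rightarrow>\<^sub>M T"
  shows "indep_var S X T Y"
proof -
  have sub: "sets N1 \<subseteq> events" "sets N2 \<subseteq> events"
    using ind unfolding indep_set_def indep_sets_def by (auto split: bool.splits)
  have X': "{X -` A \<inter> space M |A. A \<in> sets S} \<subseteq> sets N1"
    using measurable_sets[OF X] by (auto simp: space)
  have Y': "{Y -` A \<inter> space M |A. A \<in> sets T} \<subseteq> sets N2"
    using measurable_sets[OF Y] by (auto simp: space)
  have "random_variable S X" "random_variable T Y"
    using X Y unfolding measurable_def space
    by (auto intro: subsetD[OF sub(1)] subsetD[OF sub(2)])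
  moreover have "indep_set (sigma_sets (space M) {X -` A \<inter> space M |A. A \<in> sets S})
      (sigma_sets (space M) {Y -` A \<inter> space M |A. A \<in> sets T})"
    using sets.sigma_sets_subset[OF X'] sets.sigma_sets_subset[OF Y'] ind
    unfolding indep_set_def space
    by (elim indep_sets_mono_sets) (auto split: bool.splits)
  ultimately show ?thesis unfolding indep_var_eq by blast
qed

section \<open>Probability that two sketches agree\<close>

text \<open>By independence the joint law is a product of uniform laws. Given the value
  \<open>y\<close> at \<open>e\<close>, each of the other \<open>card E - 1\<close> values lies
  below \<open>y\<close> with probability \<open>y\<close>, and integrating
  \<open>y ^ (card E - 1)\<close> over the unit interval gives \<open>1 / card E\<close>.\<close>

lemma (in prob_space) prob_argmax:
  fixes X :: "'i \<Rightarrow> 'a \<Rightarrow> real"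
  assumes fin: "finite E" and e: "e \<in> E"
    and ind: "indep_vars (\<lambda>_. borel) X E"
    and unif: "\<And>i. i \<in> E \<Longrightarrow> distr M borel (X i) = uniform_measure lborel {0<..<1}"
  shows "prob {\<omega> \<in> space M. \<forall>i\<in>E - {e}. X i \<omega> < X e \<omega>} = 1 / card E"
proof -
  \<comment> \<open>The divisor 1 is the length of \<open>{0<..<1}\<close>, by which
    \<open>uniform_measure\<close> normalizes.\<close>
  have div_1: "a / 1 = a" for a :: ennreal
    by (simp add: divide_ennreal_def)
  define U where "U = uniform_measure lborel {0<..<1::real}"
  define R where "R = E - {e}"
  have R: "finite R" "e \<notin> R" "E = insert e R" using fin e by (auto simp: R_def)
  have setsU[measurable_cong]: "sets U = sets borel" by (simp add: U_def)
  interpret U: prob_space U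
    unfolding U_def by (rule prob_space_uniform_measure) auto
  interpret P: product_prob_space "\<lambda>_::'i. U" by standard
  have X[measurable]: "X i \<in> borel_measurable M" if "i \<in> E" for i
    using ind that unfolding indep_vars_def2 by auto
  have eq: "distr M (\<Pi>\<^sub>M i\<in>E. borel) (\<lambda>x. \<lambda>i\<in>E. X i x) = (\<Pi>\<^sub>M i\<in>E. U)"
  proof -
    have "distr M (\<Pi>\<^sub>M i\<in>E. borel) (\<lambda>x. \<lambda>i\<in>E. X i x) = (\<Pi>\<^sub>M i\<in>E. distr M borel (X i))"
      using ind e by (subst indep_vars_iff_distr_eq_PiM'[symmetric]) auto
    also have "\<dots> = (\<Pi>\<^sub>M i\<in>E. U)"
      by (intro PiM_cong) (auto simp: unif U_def)
    finally show ?thesis .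
  qed
  define Q where "Q = {f \<in> space (\<Pi>\<^sub>M i\<in>E. (borel :: real measure)). \<forall>i\<in>R. f i < f e}"
  have Q[measurable]: "Q \<in> sets (\<Pi>\<^sub>M i\<in>E. borel)"
    unfolding Q_def using R(1) by (intro sets.sets_Collect_finite_All) (auto simp: R)
  have Q'[measurable]: "Q \<in> sets (\<Pi>\<^sub>M i\<in>E. U)"
    using Q by (simp cong: sets_PiM_cong add: setsU)
  \<comment> \<open>The section of \<open>Q\<close> at \<open>y\<close> is the box of functions on
    \<open>R\<close> with all values below \<open>y\<close>.\<close>
  have slice: "(\<integral>\<^sup>+ f. indicator Q (f(e := y)) \<partial>(\<Pi>\<^sub>M i\<in>R. U)) = ennreal (y ^ card R)"
    if y: "y \<in> {0<..<1}" for y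
  proof -
    have "(\<integral>\<^sup>+ f. indicator Q (f(e := y)) \<partial>(\<Pi>\<^sub>M i\<in>R. U))
        = (\<integral>\<^sup>+ f. indicator (Pi\<^sub>E R (\<lambda>_. {..<y})) f \<partial>(\<Pi>\<^sub>M i\<in>R. U))"
      by (intro nn_integral_cong)
        (auto simp: Q_def R space_PiM PiE_iff indicator_def extensional_def)
    also have "\<dots> = (\<Prod>i\<in>R. emeasure U {..<y})"
      using R(1) by (subst nn_integral_indicator) (auto simp: P.emeasure_PiM setsU)
    also have "emeasure U {..<y} = ennreal y"
    proof -
      have "{0<..<1} \<inter> {..<y} = {0<..<y}" using y by auto
      then show ?thesis using y by (simp add: U_def div_1)
    qed
    also have "(\<Prod>i\<in>R. ennreal y) = ennreal (y ^ card R)"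
      using y by (simp add: ennreal_power)
    finally show ?thesis .
  qed
  have "emeasure M {\<omega> \<in> space M. \<forall>i\<in>E - {e}. X i \<omega> < X e \<omega>}
      = emeasure (distr M (\<Pi>\<^sub>M i\<in>E. borel) (\<lambda>x. \<lambda>i\<in>E. X i x)) Q"
    by (subst emeasure_distr)
      (auto intro!: arg_cong[where f="emeasure M"] measurable_restrict simp: Q_def R space_PiM)
  also have "\<dots> = (\<integral>\<^sup>+ f. indicator Q f \<partial>(\<Pi>\<^sub>M i\<in>insert e R. U))"
    unfolding eq using Q' by (simp add: R)
  \<comment> \<open>Fubini, with the coordinate \<open>e\<close> as the outer variable.\<close>
  also have "\<dots> = (\<integral>\<^sup>+ y. (\<integral>\<^sup>+ f. indicator Q (f(e := y)) \<partial>(\<Pi>\<^sub>M i\<in>R. U)) \<partial>U)"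
    using R Q' by (intro P.product_nn_integral_insert_rev) auto
  also have "\<dots> = (\<integral>\<^sup>+ y. ennreal (y ^ card R) \<partial>U)"
  proof (rule nn_integral_cong_AE)
    have "AE y in U. y \<in> {0<..<1}"
      unfolding U_def by (rule AE_uniform_measureI) auto
    then show "AE y in U. (\<integral>\<^sup>+ f. indicator Q (f(e := y)) \<partial>(\<Pi>\<^sub>M i\<in>R. U)) = ennreal (y ^ card R)"
      by eventually_elim (rule slice)
  qed
  also have "\<dots> = (\<integral>\<^sup>+ y. ennreal (y ^ card R) * indicator {0<..<1} y \<partial>lborel)"
    unfolding U_def by (subst nn_integral_uniform_measure) (auto simp: div_1)
  \<comment> \<open>Adding the two endpoints, a null set, yields the compact interval on which the
    fundamental theorem of calculus is applied.\<close>
  also have "\<dots> = (\<integral>\<^sup>+ y. ennreal (y ^ card R) * indicator {0..1} y \<partial>lborel)"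
  proof (rule nn_integral_cong_AE)
    show "AE y in lborel. ennreal (y ^ card R) * indicator {0<..<1} y = ennreal (y ^ card R) * indicator {0..1} y"
      using AE_lborel_singleton[of "0::real"] AE_lborel_singleton[of "1::real"]
      by eventually_elim (auto simp: indicator_def)
  qed
  also have "\<dots> = ennreal (1 ^ Suc (card R) / Suc (card R) - 0 ^ Suc (card R) / Suc (card R))"
  proof (rule nn_integral_FTC_Icc)
    show "((\<lambda>y. y ^ Suc (card R) / Suc (card R)) has_real_derivative x ^ card R) (at x)" for x
      using DERIV_cdivide[OF DERIV_pow[of "Suc (card R)" x UNIV], of "real (Suc (card R))"]
      by (simp del: power_Suc of_nat_Suc)
  qed auto
  also have "\<dots> = ennreal (1 / card E)"
    using R by simp
  finally show ?thesis by (simp add: measure_def)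
qed

text \<open>On \<open>F e\<close> the sketches agree if \<open>e\<close> lies in both sets and
  differ if it lies in only one. Counting these disjoint events bounds the probabilities of
  agreement and of disagreement from below.\<close>

lemma (in prob_space) prob_Max_eq:
  fixes X :: "'i \<Rightarrow> 'a \<Rightarrow> real"
  assumes fin: "finite A" "finite B" and ne: "A \<inter> B \<noteq> {}"
    and ind: "indep_vars (\<lambda>_. borel) X (A \<union> B)"
    and unif: "\<And>i. i \<in> A \<union> B \<Longrightarrow> distr M borel (X i) = uniform_measure lborel {0<..<1}"
  shows "prob {\<omega> \<in> space M. Max ((\<lambda>i. X i \<omega>) ` A) = Max ((\<lambda>i. X i \<omega>) ` B)} = jaccard A B"
proof -
  define E where "E = A \<union> B"
  define C where "C = {\<omega> \<in> space M. Max ((\<lambda>i. X i \<omega>) ` A) = Max ((\<lambda>i. X i \<omega>) ` B)}"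
  define F where "F e = {\<omega> \<in> space M. \<forall>i\<in>E - {e}. X i \<omega> < X e \<omega>}" for e
  have finE: "finite E" and cardE: "card E > 0" 
    using fin ne by (auto simp: E_def card_gt_0_iff)
  have AB: "A \<noteq> {}" "B \<noteq> {}" using ne by auto
  have X[measurable]: "X i \<in> borel_measurable M" if "i \<in> E" for i
    using ind that unfolding indep_vars_def2 E_def by auto
  have F[measurable]: "F e \<in> events" if "e \<in> E" for e
    unfolding F_def using finE that by (intro sets.sets_Collect_finite_All) auto
  have [measurable]: "(\<lambda>\<omega>. Max ((\<lambda>i. X i \<omega>) ` A)) \<in> borel_measurable M"
    "(\<lambda>\<omega>. Max ((\<lambda>i. X i \<omega>) ` B)) \<in> borel_measurable M"
    using fin AB by (auto intro!: borel_measurable_Max simp: E_def)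
  have C[measurable]: "C \<in> events" unfolding C_def by measurable
  have probF: "prob (F e) = 1 / card E" if "e \<in> E" for e
    unfolding F_def using prob_argmax[OF finE that] ind unif by (auto simp: E_def)
  have disj: "disjoint_family_on F E"
  proof (unfold disjoint_family_on_def, safe)
    fix i j \<omega> assume "i \<in> E" "j \<in> E" "i \<noteq> j" "\<omega> \<in> F i" "\<omega> \<in> F j"
    then have "X j \<omega> < X i \<omega>" "X i \<omega> < X j \<omega>" by (auto simp: F_def)
    then show "\<omega> \<in> {}" by simp
  qed
  have sumF: "prob (\<Union>e\<in>K. F e) = card K / card E" if "K \<subseteq> E" for K
  proof -
    have "prob (\<Union>e\<in>K. F e) = (\<Sum>e\<in>K. prob (F e))"
      using that finite_subset[OF that finE] disj F
      by (intro finite_measure_finite_Union) (auto intro: disjoint_family_on_mono)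
    also have "\<dots> = (\<Sum>e\<in>K. 1 / card E)" using that by (intro sum.cong) (auto simp: probF)
    finally show ?thesis by simp
  qed
  have Max_eq: "Max ((\<lambda>i. X i \<omega>) ` K) = X e \<omega>" if "\<omega> \<in> F e" "e \<in> K" "K \<subseteq> E" for \<omega> e K
  proof (rule Max_eqI)
    show "finite ((\<lambda>i. X i \<omega>) ` K)" using that(3) finE finite_subset by blast
    show "y \<le> X e \<omega>" if "y \<in> (\<lambda>i. X i \<omega>) ` K" for y
      using that \<open>\<omega> \<in> F e\<close> \<open>K \<subseteq> E\<close> by (cases "y = X e \<omega>") (auto simp: F_def intro!: less_imp_le)
  qed (use that in auto)
  have Max_less: "Max ((\<lambda>i. X i \<omega>) ` K) < X e \<omega>"
    if "\<omega> \<in> F e" "e \<notin> K" "K \<subseteq> E" "K \<noteq> {}" for \<omega> e K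
    using that finite_subset[OF that(3) finE] by (subst Max_less_iff) (auto simp: F_def)
  have AB_sub: "A \<inter> B \<subseteq> E" by (auto simp: E_def)
  have "(\<Union>e\<in>A \<inter> B. F e) \<subseteq> C"
    using Max_eq[of _ _ A] Max_eq[of _ _ B] by (auto simp: C_def E_def F_def)
  then have "card (A \<inter> B) / card E \<le> prob C"
    using sumF[OF AB_sub] finite_measure_mono[OF _ C, of "\<Union>e\<in>A \<inter> B. F e"] by simp
  moreover have "(\<Union>e\<in>E - A \<inter> B. F e) \<subseteq> space M - C"
  proof
    fix \<omega> assume "\<omega> \<in> (\<Union>e\<in>E - A \<inter> B. F e)"
    then obtain e where e: "\<omega> \<in> F e" and "e \<in> A \<and> e \<notin> B \<or> e \<in> B \<and> e \<notin> A"
      by (auto simp: E_def)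
    then have "Max ((\<lambda>i. X i \<omega>) ` A) \<noteq> Max ((\<lambda>i. X i \<omega>) ` B)"
    proof (elim disjE conjE)
      assume "e \<in> A" "e \<notin> B"
      then show ?thesis
        using Max_eq[OF e, of A] Max_less[OF e, of B] AB by (auto simp: E_def)
    next
      assume "e \<in> B" "e \<notin> A"
      then show ?thesis
        using Max_eq[OF e, of B] Max_less[OF e, of A] AB by (auto simp: E_def)
    qed
    with e show "\<omega> \<in> space M - C" by (auto simp: C_def F_def)
  qed
  then have "card (E - A \<inter> B) / card E \<le> 1 - prob C"
    using sumF[of "E - A \<inter> B"] finite_measure_mono[OF _ sets.compl_sets[OF C], of "\<Union>e\<in>E - A \<inter> B. F e"]
      prob_compl[OF C] by auto
  \<comment> \<open>The two lower bounds add up to 1, so both are equalities; ties are thereby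
    covered.\<close>
  moreover have "card (E - A \<inter> B) / card E = 1 - card (A \<inter> B) / card E"
  proof -
    have "real (card (E - A \<inter> B)) = real (card E) - real (card (A \<inter> B))"
      using finE AB_sub by (simp add: card_Diff_subset finite_subset card_mono of_nat_diff)
    then show ?thesis using cardE by (simp add: diff_divide_distrib)
  qed
  ultimately show ?thesis by (simp add: C_def[symmetric] jaccard_def E_def[symmetric])
qed

section \<open>Limits of characteristic functions and convergence in probability\<close>

text \<open>The central limit theorem on the level of characteristic functions, including
  \<open>v = 0\<close>, which occurs when \<open>\<rho> = 1\<close>. The second-order expansion of
  \<open>char M\<close> is compared with \<open>1 - t\<^sup>2 * v / (2 * n)\<close>; for numbers in
  the closed unit disc, the powers with exponent \<open>n\<close> differ by at most \<open>n\<close>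
  times the difference of the bases.\<close>

lemma (in real_distribution) char_power_tendsto:
  assumes int1: "integrable M (\<lambda>x. x)" and mean: "expectation (\<lambda>x. x) = 0"
    and int2: "integrable M (\<lambda>x. x\<^sup>2)" and var: "variance (\<lambda>x. x) = v"
  shows "(\<lambda>n. char M (t / sqrt (real n)) ^ n) \<longlonglongrightarrow> complex_of_real (exp (- (t\<^sup>2 * v / 2)))"
proof -
  \<comment> \<open>The remainder integral of the expansion. The cap \<open>6 * x\<^sup>2\<close> is
    an integrable majorant independent of \<open>n\<close>, while the other argument of
    \<open>min\<close> tends to 0 pointwise, so dominated convergence applies.\<close>
  define J where "J n = (\<integral>x. min (6 * x\<^sup>2) (\<bar>t / sqrt (real n)\<bar> * \<bar>x\<bar> ^ 3) \<partial>M)" for n :: nat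
  have v: "v \<ge> 0" unfolding var[symmetric] by simp
  \<comment> \<open>The threshold \<open>t\<^sup>2 * v / 4\<close> keeps
    \<open>1 - t\<^sup>2 * v / (2 * n)\<close> at or above -1, so that both bases lie in the unit
    disc.\<close>
  have bound: "cmod (char M (t / sqrt (real n)) ^ n - complex_of_real ((1 + (- (t\<^sup>2 * v / 2)) / real n) ^ n))
      \<le> t\<^sup>2 / 6 * J n" if n: "n \<ge> max 1 (nat \<lceil>t\<^sup>2 * v / 4\<rceil>)" for n :: nat
  proof -
    let ?t = "t / sqrt (real n)"
    have n0: "0 < n" and n1: "t\<^sup>2 * v / 4 \<le> n" using n by linarith+
    have eq: "1 + (- (t\<^sup>2 * v / 2)) / real n = 1 - ?t\<^sup>2 * v / 2"
      using n0 by (simp add: power_divide)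
    have le1: "\<bar>1 - ?t\<^sup>2 * v / 2\<bar> \<le> 1"
      using n0 n1 v by (auto simp: power_divide abs_le_iff field_simps)
    have "cmod (char M ?t ^ n - complex_of_real (1 - ?t\<^sup>2 * v / 2) ^ n)
        \<le> n * cmod (char M ?t - complex_of_real (1 - ?t\<^sup>2 * v / 2))"
      by (intro norm_power_diff cmod_char_le_1) (simp only: norm_of_real le1)
    also have "\<dots> \<le> n * (?t\<^sup>2 / 6 * J n)"
      using char_approx3[OF int1 mean int2 var, of ?t] unfolding J_def
      by (intro mult_left_mono) auto
    also have "\<dots> = t\<^sup>2 / 6 * J n" using n0 by (simp add: power_divide)
    finally show ?thesis unfolding eq by (simp only: of_real_power)
  qed
  have "J \<longlonglongrightarrow> (\<integral>x. 0 \<partial>M)"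
    unfolding J_def
  proof (rule integral_dominated_convergence[where w = "\<lambda>x. 6 * x\<^sup>2"])
    show "AE x in M. (\<lambda>n. min (6 * x\<^sup>2) (\<bar>t / sqrt (real n)\<bar> * \<bar>x\<bar> ^ 3)) \<longlonglongrightarrow> 0"
    proof (rule AE_I2)
      fix x :: real
      have "(\<lambda>n. \<bar>t / sqrt (real n)\<bar>) \<longlonglongrightarrow> \<bar>0\<bar>"
        by (intro tendsto_rabs tendsto_divide_0[OF tendsto_const] filterlim_at_top_imp_at_infinity
            filterlim_compose[OF sqrt_at_top filterlim_real_sequentially])
      then have "(\<lambda>n. \<bar>t / sqrt (real n)\<bar>) \<longlonglongrightarrow> 0" by simp
      from tendsto_min[OF tendsto_const[of "6 * x\<^sup>2"] tendsto_mult_right[OF this, of "\<bar>x\<bar> ^ 3"]]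
      show "(\<lambda>n. min (6 * x\<^sup>2) (\<bar>t / sqrt (real n)\<bar> * \<bar>x\<bar> ^ 3)) \<longlonglongrightarrow> 0"
        by simp
    qed
  qed (use int2 in auto)
  then have J: "(\<lambda>n. t\<^sup>2 / 6 * J n) \<longlonglongrightarrow> 0"
    by (simp add: tendsto_mult_right_zero)
  have "(\<lambda>n. complex_of_real ((1 + (- (t\<^sup>2 * v / 2)) / real n) ^ n)) \<longlonglongrightarrow> complex_of_real (exp (- (t\<^sup>2 * v / 2)))"
    by (intro tendsto_of_real tendsto_exp_limit_sequentially)
  then show ?thesis
    by (rule Lim_transform)
      (rule Lim_null_comparison[OF eventually_sequentiallyI[OF bound] J])
qed

text \<open>Slutsky's theorem for sums, for characteristic functions at a single \<open>t\<close>.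
  Since \<open>\<bar>iexp x - 1\<bar>\<close> is at most \<open>\<bar>x\<bar>\<close> and at most 2,
  the change is at most \<open>\<bar>t\<bar> * \<delta>\<close> where \<open>\<bar>R n\<bar>\<close>
  is at most \<open>\<delta>\<close>, and at most 2 on the rare event where it is larger.\<close>

lemma (in prob_space) char_add_null:
  fixes W R :: "nat \<Rightarrow> 'a \<Rightarrow> real"
  assumes W[measurable]: "\<And>n. random_variable borel (W n)"
    and R[measurable]: "\<And>n. random_variable borel (R n)"
    and null: "\<And>\<epsilon>. \<epsilon> > 0 \<Longrightarrow> (\<lambda>n. prob {\<omega> \<in> space M. \<epsilon> < \<bar>R n \<omega>\<bar>}) \<longlonglongrightarrow> 0"
    and lim: "(\<lambda>n. char (distr M borel (W n)) t) \<longlonglongrightarrow> L"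
  shows "(\<lambda>n. char (distr M borel (\<lambda>\<omega>. W n \<omega> + R n \<omega>)) t) \<longlonglongrightarrow> L"
proof -
  have int: "integrable M (\<lambda>\<omega>. iexp (f \<omega>))" if "f \<in> borel_measurable M" for f
    using that by (intro integrable_const_bound[where B=1]) auto
  have bound: "cmod (char (distr M borel (\<lambda>\<omega>. W n \<omega> + R n \<omega>)) t - char (distr M borel (W n)) t)
      \<le> \<bar>t\<bar> * \<delta> + 2 * prob {\<omega> \<in> space M. \<delta> < \<bar>R n \<omega>\<bar>}" if "\<delta> > 0" for n \<delta>
  proof -
    let ?B = "{\<omega> \<in> space M. \<delta> < \<bar>R n \<omega>\<bar>}"
    have "cmod (char (distr M borel (\<lambda>\<omega>. W n \<omega> + R n \<omega>)) t - char (distr M borel (W n)) t)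
        = cmod (\<integral>\<omega>. iexp (t * (W n \<omega> + R n \<omega>)) - iexp (t * W n \<omega>) \<partial>M)"
      by (subst Bochner_Integration.integral_diff)
        (auto simp del: of_real_mult of_real_add simp: char_def integral_distr int)
    also have "\<dots> \<le> (\<integral>\<omega>. cmod (iexp (t * (W n \<omega> + R n \<omega>)) - iexp (t * W n \<omega>)) \<partial>M)"
      by (rule integral_norm_bound)
    also have "\<dots> \<le> (\<integral>\<omega>. \<bar>t\<bar> * \<delta> + 2 * indicator ?B \<omega> \<partial>M)"
    proof (rule integral_mono)
      fix \<omega> assume "\<omega> \<in> space M"
      \<comment> \<open>Factoring out a number of modulus 1 removes \<open>W n\<close> from the
        estimate.\<close>
      have "iexp (t * (W n \<omega> + R n \<omega>)) - iexp (t * W n \<omega>) = iexp (t * W n \<omega>) * (iexp (t * R n \<omega>) - 1)"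
        by (simp add: algebra_simps exp_add)
      then have eq: "cmod (iexp (t * (W n \<omega> + R n \<omega>)) - iexp (t * W n \<omega>)) = cmod (iexp (t * R n \<omega>) - 1)"
        by (simp add: norm_mult)
      have "cmod (iexp (t * R n \<omega>) - 1) \<le> \<bar>t\<bar> * \<bar>R n \<omega>\<bar>" "cmod (iexp (t * R n \<omega>) - 1) \<le> 2"
        using iexp_approx1[of "t * R n \<omega>" 0] iexp_approx2[of "t * R n \<omega>" 0] by (simp_all add: abs_mult)
      moreover have "0 \<le> \<bar>t\<bar> * \<delta>" using \<open>\<delta> > 0\<close> by simp
      ultimately show "cmod (iexp (t * (W n \<omega> + R n \<omega>)) - iexp (t * W n \<omega>)) \<le> \<bar>t\<bar> * \<delta> + 2 * indicator ?B \<omega>"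
        using \<open>\<omega> \<in> space M\<close> mult_left_mono[of "\<bar>R n \<omega>\<bar>" \<delta> "\<bar>t\<bar>"]
        unfolding eq by (cases "\<delta> < \<bar>R n \<omega>\<bar>") auto
    qed (auto simp del: of_real_mult of_real_add simp: less_top[symmetric]
        intro!: Bochner_Integration.integrable_diff Bochner_Integration.integrable_add
          integrable_mult_right integrable_norm int)
    also have "\<dots> = \<bar>t\<bar> * \<delta> + 2 * prob ?B"
      by (subst Bochner_Integration.integral_add) (auto simp: prob_space less_top[symmetric])
    finally show ?thesis .
  qed
  have "(\<lambda>n. char (distr M borel (\<lambda>\<omega>. W n \<omega> + R n \<omega>)) t - char (distr M borel (W n)) t) \<longlonglongrightarrow> 0"
  proof (rule LIMSEQ_I)
    fix r :: real assume r: "r > 0"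
    \<comment> \<open>Each of the two error terms gets less than \<open>r / 2\<close>; the added 1
      covers \<open>t = 0\<close>.\<close>
    define \<delta> where "\<delta> = r / (2 * (\<bar>t\<bar> + 1))"
    have \<delta>: "\<delta> > 0" "\<bar>t\<bar> * \<delta> < r / 2" using r by (auto simp: \<delta>_def field_simps)
    obtain n0 where "\<And>n. n \<ge> n0 \<Longrightarrow> norm (prob {\<omega> \<in> space M. \<delta> < \<bar>R n \<omega>\<bar>} - 0) < r / 4"
      using LIMSEQ_D[OF null[OF \<delta>(1)], of "r / 4"] r by auto
    then show "\<exists>n0. \<forall>n\<ge>n0. norm (char (distr M borel (\<lambda>\<omega>. W n \<omega> + R n \<omega>)) t
        - char (distr M borel (W n)) t - 0) < r"
      using bound[OF \<delta>(1)] \<delta>(2) by (intro exI[of _ n0]) (fastforce intro: le_less_trans)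
  qed
  from tendsto_add[OF this lim] show ?thesis by simp
qed

text \<open>Weak convergence makes \<open>Y\<close> tight: for large \<open>n\<close> it leaves the
  interval from \<open>- k\<close> to \<open>k\<close> only with small probability. Inside that
  interval, \<open>\<bar>Z n * Y n\<bar>\<close> can exceed \<open>\<epsilon>\<close> only if
  \<open>\<bar>Z n\<bar>\<close> is at least \<open>\<epsilon> / k\<close>.\<close>

lemma (in prob_space) prob_mult_null:
  fixes Z Y :: "nat \<Rightarrow> 'a \<Rightarrow> real"
  assumes Z[measurable]: "\<And>n. random_variable borel (Z n)"
    and Y[measurable]: "\<And>n. random_variable borel (Y n)"
    and null: "\<And>\<epsilon>. \<epsilon> > 0 \<Longrightarrow> (\<lambda>n. prob {\<omega> \<in> space M. \<epsilon> \<le> \<bar>Z n \<omega>\<bar>}) \<longlonglongrightarrow> 0"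
    and conv: "weak_conv_m (\<lambda>n. distr M borel (Y n)) N"
    and N: "real_distribution N" "\<And>x. isCont (cdf N) x"
    and \<epsilon>: "\<epsilon> > 0"
  shows "(\<lambda>n. prob {\<omega> \<in> space M. \<epsilon> < \<bar>Z n \<omega> * Y n \<omega>\<bar>}) \<longlonglongrightarrow> 0"
proof (rule LIMSEQ_I)
  fix r :: real assume r: "r > 0"
  interpret N: real_distribution N by fact
  have "eventually (\<lambda>k. 1 - r / 6 < cdf N k) at_top"
    using N.cdf_lim_at_top_prob r by (intro order_tendstoD) auto
  moreover have "((\<lambda>k. cdf N (- k)) \<longlongrightarrow> 0) at_top"
    using N.cdf_lim_at_bot filterlim_uminus_at_bot_at_top by (rule filterlim_compose)
  then have "eventually (\<lambda>k. cdf N (- k) < r / 6) at_top"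
    using r by (intro order_tendstoD) auto
  ultimately have "eventually (\<lambda>k. 1 - r / 6 < cdf N k \<and> cdf N (- k) < r / 6 \<and> 0 < k) at_top"
    using eventually_gt_at_top[of 0] by eventually_elim auto
  then obtain k where k: "1 - r / 6 < cdf N k" "cdf N (- k) < r / 6" "0 < k"
    by (auto simp: eventually_at_top_linorder)
  \<comment> \<open>Continuity of \<open>cdf N\<close> gives convergence at every point, in
    particular at \<open>k\<close> and \<open>- k\<close>.\<close>
  have lim: "(\<lambda>n. cdf (distr M borel (Y n)) x) \<longlonglongrightarrow> cdf N x" for x
    using conv N(2) unfolding weak_conv_m_def weak_conv_def by blast
  have "eventually (\<lambda>n. 1 - r / 6 < cdf (distr M borel (Y n)) k) sequentially"
    by (rule order_tendstoD(1)[OF lim k(1)])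
  moreover have "eventually (\<lambda>n. cdf (distr M borel (Y n)) (- k) < r / 6) sequentially"
    by (rule order_tendstoD(2)[OF lim k(2)])
  moreover have "eventually (\<lambda>n. prob {\<omega> \<in> space M. \<epsilon> / k \<le> \<bar>Z n \<omega>\<bar>} < r / 6) sequentially"
    using null[of "\<epsilon> / k"] \<epsilon> k(3) r by (intro order_tendstoD) auto
  ultimately have "eventually (\<lambda>n. prob {\<omega> \<in> space M. \<epsilon> < \<bar>Z n \<omega> * Y n \<omega>\<bar>} < r) sequentially"
  proof eventually_elim
    case (elim n)
    let ?D = "distr M borel (Y n)"
    interpret D: real_distribution ?D by (rule real_distribution_distr) simp
    have Yn: "prob {\<omega> \<in> space M. - k < Y n \<omega> \<and> Y n \<omega> \<le> k} = cdf ?D k - cdf ?D (- k)"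
      using k(3) by (subst D.cdf_diff_eq)
        (auto simp: measure_distr intro!: arg_cong[where f=prob])
    have "prob {\<omega> \<in> space M. \<not> (- k < Y n \<omega> \<and> Y n \<omega> \<le> k)} =
        1 - prob {\<omega> \<in> space M. - k < Y n \<omega> \<and> Y n \<omega> \<le> k}"
      by (rule prob_neg) measurable
    with Yn elim have *: "prob {\<omega> \<in> space M. \<not> (- k < Y n \<omega> \<and> Y n \<omega> \<le> k)} < r / 3"
      by linarith
    have "{\<omega> \<in> space M. \<epsilon> < \<bar>Z n \<omega> * Y n \<omega>\<bar>} \<subseteq>
        {\<omega> \<in> space M. \<not> (- k < Y n \<omega> \<and> Y n \<omega> \<le> k)} \<union> {\<omega> \<in> space M. \<epsilon> / k \<le> \<bar>Z n \<omega>\<bar>}"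
    proof safe
      fix \<omega> assume a: "\<epsilon> < \<bar>Z n \<omega> * Y n \<omega>\<bar>" "\<not> \<epsilon> / k \<le> \<bar>Z n \<omega>\<bar>" "- k < Y n \<omega>" "Y n \<omega> \<le> k"
      then have "\<bar>Z n \<omega>\<bar> * \<bar>Y n \<omega>\<bar> \<le> (\<epsilon> / k) * k" using k \<epsilon> by (intro mult_mono) auto
      with a k show False by (simp add: abs_mult)
    qed
    then have "prob {\<omega> \<in> space M. \<epsilon> < \<bar>Z n \<omega> * Y n \<omega>\<bar>} \<le>
        prob ({\<omega> \<in> space M. \<not> (- k < Y n \<omega> \<and> Y n \<omega> \<le> k)} \<union> {\<omega> \<in> space M. \<epsilon> / k \<le> \<bar>Z n \<omega>\<bar>})"
      by (intro finite_measure_mono) auto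
    also have "\<dots> \<le> prob {\<omega> \<in> space M. \<not> (- k < Y n \<omega> \<and> Y n \<omega> \<le> k)} + prob {\<omega> \<in> space M. \<epsilon> / k \<le> \<bar>Z n \<omega>\<bar>}"
      by (intro measure_Un_le) auto
    also have "\<dots> < r" using * elim r by linarith
    finally show ?case .
  qed
  then show "\<exists>n0. \<forall>n\<ge>n0. norm (prob {\<omega> \<in> space M. \<epsilon> < \<bar>Z n \<omega> * Y n \<omega>\<bar>} - 0) < r"
    by (auto simp: eventually_sequentially)
qed

section \<open>Sums of independent indicators\<close>

lemma (in prob_space) char_distr_scale:
  assumes [measurable]: "random_variable borel X"
  shows "char (distr M borel (\<lambda>\<omega>. c * X \<omega>)) t = char (distr M borel X) (c * t)"
  by (simp add: char_def integral_distr mult_ac)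

text \<open>The right-hand side depends on \<open>P\<close> only through its probability, so
  indicators with equal probability share one characteristic function.\<close>

lemma (in prob_space) char_centered_of_bool:
  assumes [measurable]: "Measurable.pred M P"
  shows "char (distr M borel (\<lambda>\<omega>. of_bool (P \<omega>) - p)) t =
    iexp (- (t * p)) + complex_of_real (\<P>(\<omega> in M. P \<omega>)) * (iexp (t * (1 - p)) - iexp (- (t * p)))"
proof -
  let ?C = "{\<omega> \<in> space M. P \<omega>}"
  have "char (distr M borel (\<lambda>\<omega>. of_bool (P \<omega>) - p)) t = (\<integral>\<omega>. iexp (t * (of_bool (P \<omega>) - p)) \<partial>M)"
    by (simp add: char_def integral_distr)
  also have "\<dots> = (\<integral>\<omega>. iexp (- (t * p)) + complex_of_real (indicator ?C \<omega>) * (iexp (t * (1 - p)) - iexp (- (t * p))) \<partial>M)"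
    by (intro Bochner_Integration.integral_cong) (auto simp: indicator_def algebra_simps)
  also have "\<dots> = iexp (- (t * p)) + complex_of_real (prob ?C) * (iexp (t * (1 - p)) - iexp (- (t * p)))"
    by (subst Bochner_Integration.integral_add)
      (auto simp: prob_space less_top[symmetric] intro!: integrable_mult_left integrable_of_real)
  finally show ?thesis .
qed

lemma (in prob_space) expectation_of_bool:
  assumes [measurable]: "Measurable.pred M P"
  shows "expectation (\<lambda>\<omega>. of_bool (P \<omega>) :: real) = \<P>(\<omega> in M. P \<omega>)"
proof -
  have "expectation (\<lambda>\<omega>. of_bool (P \<omega>) :: real) = expectation (indicator {\<omega> \<in> space M. P \<omega>})"
    by (intro Bochner_Integration.integral_cong) (auto simp: indicator_def)
  then show ?thesis by simp
qed

text \<open>The indicators form a triangular array, because the sets and hash functions change with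
  \<open>n\<close>. Within each row they are independent with the same \<open>p\<close>, so every
  row sum has a power of one fixed characteristic function. The scale \<open>q\<close> is separate
  from the variance \<open>p * (1 - p)\<close>: the application takes
  \<open>q = p = \<rho>\<close>.\<close>

lemma (in prob_space) char_sum_of_bool_tendsto:
  fixes P :: "nat \<Rightarrow> nat \<Rightarrow> 'a \<Rightarrow> bool"
  assumes P[measurable]: "\<And>n j. j \<in> {1..Suc n} \<Longrightarrow> Measurable.pred M (P n j)"
    and p: "\<And>n j. j \<in> {1..Suc n} \<Longrightarrow> \<P>(\<omega> in M. P n j \<omega>) = p"
    and ind: "\<And>n. indep_vars (\<lambda>_. borel) (\<lambda>j \<omega>. of_bool (P n j \<omega>) :: real) {1..Suc n}"
    and q: "q > 0"
  shows "(\<lambda>n. char (distr M borel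
            (\<lambda>\<omega>. (\<Sum>j=1..Suc n. of_bool (P n j \<omega>) - p) / sqrt (real (Suc n) * q))) t)
    \<longlonglongrightarrow> complex_of_real (exp (- (t\<^sup>2 / q * (p * (1 - p)) / 2)))"
proof -
  \<comment> \<open>The first entry of the first row serves as representative of the common
    law.\<close>
  define \<mu> where "\<mu> = distr M borel (\<lambda>\<omega>. of_bool (P 0 1 \<omega>) - p)"
  have [measurable]: "Measurable.pred M (P 0 1)" by (rule P) simp
  have ex: "expectation (\<lambda>\<omega>. of_bool (P 0 1 \<omega>)) = p"
    by (subst expectation_of_bool) (simp_all add: p)
  have int: "integrable M (\<lambda>\<omega>. of_bool (P 0 1 \<omega>) :: real)"
    by (rule integrable_const_bound[where B=1]) auto
  have sq: "(of_bool b - p)\<^sup>2 = (1 - 2 * p) * of_bool b + p\<^sup>2" for b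
    by (cases b) (auto simp: power2_eq_square algebra_simps)
  have \<mu>_mean: "integral\<^sup>L \<mu> (\<lambda>x. x) = 0"
    unfolding \<mu>_def using int ex by (simp add: integral_distr prob_space)
  have \<mu>_var: "integral\<^sup>L \<mu> (\<lambda>x. x\<^sup>2) = p * (1 - p)"
    unfolding \<mu>_def using int ex
    by (simp add: integral_distr sq prob_space) (simp add: power2_eq_square algebra_simps)
  interpret \<mu>: real_distribution \<mu>
    unfolding \<mu>_def by (rule real_distribution_distr) simp
  have lim: "(\<lambda>n. char \<mu> (t / sqrt q / sqrt (real n)) ^ n)
      \<longlonglongrightarrow> complex_of_real (exp (- ((t / sqrt q)\<^sup>2 * (p * (1 - p)) / 2)))"
  proof (rule \<mu>.char_power_tendsto)
    show "integrable \<mu> (\<lambda>x. x)" "integrable \<mu> (\<lambda>x. x\<^sup>2)"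
      unfolding \<mu>_def using int by (auto simp: integrable_distr_eq sq)
  qed (simp_all add: \<mu>_mean \<mu>_var)
  have "char (distr M borel
          (\<lambda>\<omega>. (\<Sum>j=1..Suc n. of_bool (P n j \<omega>) - p) / sqrt (real (Suc n) * q))) t
      = char \<mu> (t / sqrt q / sqrt (real (Suc n))) ^ Suc n" for n
  proof -
    let ?s = "t / sqrt q / sqrt (real (Suc n))"
    have "char (distr M borel
          (\<lambda>\<omega>. (\<Sum>j=1..Suc n. of_bool (P n j \<omega>) - p) / sqrt (real (Suc n) * q))) t
      = char (distr M borel (\<lambda>\<omega>. \<Sum>j=1..Suc n. of_bool (P n j \<omega>) - p)) ?s"
      using char_distr_scale[of "\<lambda>\<omega>. \<Sum>j=1..Suc n. of_bool (P n j \<omega>) - p" "1 / sqrt (real (Suc n) * q)" t]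
      by (simp add: real_sqrt_mult mult_ac del: sum.cl_ivl_Suc of_nat_Suc)
    also have "\<dots> = (\<Prod>j=1..Suc n. char (distr M borel (\<lambda>\<omega>. of_bool (P n j \<omega>) - p)) ?s)"
      by (intro char_distr_sum indep_vars_compose2[OF ind]) simp
    also have "\<dots> = (\<Prod>j=1..Suc n. char \<mu> ?s)"
      unfolding \<mu>_def by (intro prod.cong refl) (simp add: char_centered_of_bool p)
    finally show ?thesis by simp
  qed
  with LIMSEQ_Suc[OF lim] q show ?thesis
    by (simp only: power_divide real_sqrt_pow2 less_imp_le)
qed

text \<open>A weak law for the same triangular array. Hoeffding's inequality bounds each row on its
  own, with a bound that is geometric in the row length.\<close>

lemma (in prob_space) prob_mean_of_bool_null:
  fixes P :: "nat \<Rightarrow> nat \<Rightarrow> 'a \<Rightarrow> bool"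
  assumes P[measurable]: "\<And>n j. j \<in> {1..Suc n} \<Longrightarrow> Measurable.pred M (P n j)"
    and p: "\<And>n j. j \<in> {1..Suc n} \<Longrightarrow> \<P>(\<omega> in M. P n j \<omega>) = p"
    and ind: "\<And>n. indep_vars (\<lambda>_. borel) (\<lambda>j \<omega>. of_bool (P n j \<omega>) :: real) {1..Suc n}"
    and \<epsilon>: "\<epsilon> > 0"
  shows "(\<lambda>n. prob {\<omega> \<in> space M. \<epsilon> \<le> \<bar>(\<Sum>j=1..Suc n. of_bool (P n j \<omega>) - p) / real (Suc n)\<bar>}) \<longlonglongrightarrow> 0"
proof (rule tendsto_sandwich[where f = "\<lambda>_. 0" and h = "\<lambda>n. 2 * exp (- 2 * \<epsilon>\<^sup>2) ^ Suc n"])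
  show "\<forall>\<^sub>F n in sequentially. prob {\<omega> \<in> space M. \<epsilon> \<le> \<bar>(\<Sum>j=1..Suc n. of_bool (P n j \<omega>) - p) / real (Suc n)\<bar>}
      \<le> 2 * exp (- 2 * \<epsilon>\<^sup>2) ^ Suc n"
  proof (rule always_eventually, rule allI)
    fix n
    have ex: "expectation (\<lambda>\<omega>. of_bool (P n j \<omega>)) = p" if j: "j \<in> {1..Suc n}" for j
      by (subst expectation_of_bool[OF P[OF j]]) (rule p[OF j])
    interpret H: Hoeffding_ineq M "{1..Suc n}" "\<lambda>j \<omega>. of_bool (P n j \<omega>)" "\<lambda>_. 0" "\<lambda>_. 1" "real (Suc n) * p"
    proof unfold_locales
      show "real (Suc n) * p \<equiv> (\<Sum>i\<in>{1..Suc n}. expectation (\<lambda>\<omega>. of_bool (P n i \<omega>)))"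
        by (rule eq_reflection) (simp add: ex del: sum.cl_ivl_Suc)
    qed (use ind[of n] in auto)
    have "{\<omega> \<in> space M. \<epsilon> \<le> \<bar>(\<Sum>j=1..Suc n. of_bool (P n j \<omega>) - p) / real (Suc n)\<bar>}
        = {\<omega> \<in> space M. \<epsilon> * real (Suc n) \<le> \<bar>(\<Sum>j\<in>{1..Suc n}. of_bool (P n j \<omega>)) - real (Suc n) * p\<bar>}"
      by (simp add: sum_subtractf pos_le_divide_eq del: sum.cl_ivl_Suc of_nat_Suc)
    then have "prob {\<omega> \<in> space M. \<epsilon> \<le> \<bar>(\<Sum>j=1..Suc n. of_bool (P n j \<omega>) - p) / real (Suc n)\<bar>}
        \<le> 2 * exp (-2 * (\<epsilon> * real (Suc n))\<^sup>2 / (\<Sum>i\<in>{1..Suc n}. (1 - 0)\<^sup>2))"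
      using H.Hoeffding_ineq_abs_ge[of "\<epsilon> * real (Suc n)"] \<epsilon> by simp
    \<comment> \<open>All ranges have length 1, so the denominator is \<open>Suc n\<close> and the
      exponent becomes linear in \<open>Suc n\<close>.\<close>
    also have "-2 * (\<epsilon> * real (Suc n))\<^sup>2 / (\<Sum>i\<in>{1..Suc n}. (1 - 0)\<^sup>2) = real (Suc n) * (-2 * \<epsilon>\<^sup>2)"
      by (simp add: power2_eq_square field_simps del: sum.cl_ivl_Suc of_nat_Suc)
    also have "exp \<dots> = exp (-2 * \<epsilon>\<^sup>2) ^ Suc n"
      by (rule exp_of_nat_mult)
    finally show "prob {\<omega> \<in> space M. \<epsilon> \<le> \<bar>(\<Sum>j=1..Suc n. of_bool (P n j \<omega>) - p) / real (Suc n)\<bar>}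
      \<le> 2 * exp (- 2 * \<epsilon>\<^sup>2) ^ Suc n" .
  qed
  have "(\<lambda>n. 2 * exp (- 2 * \<epsilon>\<^sup>2) ^ Suc n) \<longlonglongrightarrow> 2 * 0"
    using \<epsilon> by (intro tendsto_mult tendsto_const LIMSEQ_Suc[OF LIMSEQ_power_zero]) auto
  then show "(\<lambda>n. 2 * exp (- 2 * \<epsilon>\<^sup>2) ^ Suc n) \<longlonglongrightarrow> 0" by simp
qed (auto intro: tendsto_const)

section \<open>Asymptotic normality of the Scheme-2 estimator\<close>

text \<open>Discards the index 0, since the hash functions are constrained only for
  \<open>m \<ge> 1\<close>.\<close>

lemma weak_conv_m_Suc_iff: "weak_conv_m (\<lambda>n. \<mu> (Suc n)) N \<longleftrightarrow> weak_conv_m \<mu> N"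
  unfolding weak_conv_m_def weak_conv_def
  using filterlim_sequentially_Suc[of "\<lambda>n. cdf (\<mu> n) x" for x] by blast

text \<open>A law with a density has no atoms. This supplies the continuity assumed in
  \<open>prob_mult_null\<close>.\<close>

lemma isCont_cdf_std_normal: "isCont (cdf std_normal_distribution) x"
proof -
  interpret real_distribution std_normal_distribution by (rule real_dist_normal_dist)
  have "emeasure std_normal_distribution {x} = 0"
    by (simp add: emeasure_density nn_integral_indicator_singleton[where M=lborel] emeasure_lborel_singleton)
  then show ?thesis by (simp add: isCont_cdf measure_def)
qed

theorem theorem4:
  fixes M :: "'w measure"
    and A B :: "nat \<Rightarrow> 'e set"
    and S :: "nat \<Rightarrow> 'e list"
    and h :: "nat \<Rightarrow> nat \<Rightarrow> 'e \<Rightarrow> 'w \<Rightarrow> real"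
    and g1 :: "nat \<Rightarrow> 'e \<Rightarrow> 'w \<Rightarrow> real"
    and g2 :: "nat \<Rightarrow> 'e \<Rightarrow> 'w \<Rightarrow> nat"
    and \<rho> :: real
  assumes M: "prob_space M"
    and finite_sets: "\<And>m. finite (A m)" "\<And>m. finite (B m)"
    and common_element: "\<And>m. A m \<inter> B m \<noteq> {}"
    and similarity: "\<And>m. jaccard (A m) (B m) = \<rho>"
    and stream: "\<And>m. set (S m) = A m \<union> B m"
    and h_range: "\<And>m j e \<omega>. m \<ge> 1 \<Longrightarrow> j \<in> {1..m} \<Longrightarrow> e \<in> A m \<union> B m \<Longrightarrow> \<omega> \<in> space M \<Longrightarrow>
        h m j e \<omega> \<in> {0<..<1}"
    and h_uniform: "\<And>m j e. m \<ge> 1 \<Longrightarrow> j \<in> {1..m} \<Longrightarrow> e \<in> A m \<union> B m \<Longrightarrow>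
        distr M borel (h m j e) = uniform_measure lborel {0<..<1}"
    and h_indep: "\<And>m. m \<ge> 1 \<Longrightarrow>
        prob_space.indep_vars M (\<lambda>_. borel) (\<lambda>(j, e). h m j e) ({1..m} \<times> (A m \<union> B m))"
    and g1_range: "\<And>m e \<omega>. m \<ge> 1 \<Longrightarrow> e \<in> A m \<union> B m \<Longrightarrow> \<omega> \<in> space M \<Longrightarrow> g1 m e \<omega> \<in> {0<..<1}"
    and g2_range: "\<And>m e \<omega>. m \<ge> 1 \<Longrightarrow> e \<in> A m \<union> B m \<Longrightarrow> \<omega> \<in> space M \<Longrightarrow> g2 m e \<omega> \<in> {1..m}"
    and g1_measurable: "\<And>m e. m \<ge> 1 \<Longrightarrow> e \<in> A m \<union> B m \<Longrightarrow> g1 m e \<in> borel_measurable M"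
    and g2_measurable: "\<And>m e. m \<ge> 1 \<Longrightarrow> e \<in> A m \<union> B m \<Longrightarrow> g2 m e \<in> measurable M (count_space UNIV)"
    and hg_indep: "\<And>m. m \<ge> 1 \<Longrightarrow>
        prob_space.indep_set M
          (sets (vimage_algebra (space M)
             (\<lambda>\<omega>. \<lambda>(j, e)\<in>{1..m} \<times> (A m \<union> B m). h m j e \<omega>)
             (Pi\<^sub>M ({1..m} \<times> (A m \<union> B m)) (\<lambda>_. borel))))
          (sets (vimage_algebra (space M)
             (\<lambda>\<omega>. \<lambda>e\<in>A m \<union> B m. (g1 m e \<omega>, g2 m e \<omega>))
             (Pi\<^sub>M (A m \<union> B m) (\<lambda>_. borel \<Otimes>\<^sub>M count_space UNIV))))"
    and hll_performance: "asymptotically_normal M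
          (\<lambda>m \<omega>. hll_estimate m (\<lambda>e. g1 m e \<omega>) (\<lambda>e. g2 m e \<omega>) (S m))
          (\<lambda>m. real (card (A m \<union> B m)))
          (\<lambda>m. (real (card (A m \<union> B m)))\<^sup>2 / real m)"
  shows "asymptotically_normal M
          (\<lambda>m \<omega>. scheme2_estimate m (\<lambda>j e. h m j e \<omega>) (\<lambda>e. g1 m e \<omega>) (\<lambda>e. g2 m e \<omega>)
                     (A m) (B m) (S m) / real (card (A m \<inter> B m)))
          (\<lambda>m. 1)
          (\<lambda>m. 1 / (real m * \<rho>))"
proof -
  interpret prob_space M by (rule M)
  define E where "E m = A m \<union> B m" for m
  define u where "u m = real (card (E m))" for m
  \<comment> \<open>From here on \<open>Suc n\<close> plays the role of \<open>m\<close>.\<close>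
  define P where "P n j \<omega> \<longleftrightarrow> Max ((\<lambda>e. h (Suc n) j e \<omega>) ` A (Suc n)) = Max ((\<lambda>e. h (Suc n) j e \<omega>) ` B (Suc n))"
    for n j \<omega>
  define D where "D n \<omega> = (\<Sum>j=1..Suc n. of_bool (P n j \<omega>) - \<rho>) / sqrt (real (Suc n) * \<rho>)" for n \<omega>
  define H where "H m \<omega> = hll_estimate m (\<lambda>e. g1 m e \<omega>) (\<lambda>e. g2 m e \<omega>) (S m)" for m \<omega>
  define Y where "Y n \<omega> = (H (Suc n) \<omega> - u (Suc n)) / sqrt ((u (Suc n))\<^sup>2 / real (Suc n))" for n \<omega>
  \<comment> \<open>This is the error of the Jaccard estimate divided by
    \<open>sqrt \<rho>\<close>.\<close>
  define Z where "Z n \<omega> = D n \<omega> / sqrt (real (Suc n))" for n \<omega>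

  have u_pos: "u m > 0" for m
    using finite_sets common_element[of m] by (auto simp: u_def E_def card_gt_0_iff)
  have card_inter: "real (card (A m \<inter> B m)) = \<rho> * u m" for m
    using similarity[of m] u_pos[of m] by (auto simp: jaccard_def u_def E_def field_simps)
  have \<rho>: "\<rho> > 0"
  proof -
    have "real (card (A 0 \<inter> B 0)) > 0"
      using finite_sets common_element[of 0] by (simp add: card_gt_0_iff)
    then show ?thesis using card_inter[of 0] u_pos[of 0] by (simp add: zero_less_mult_iff)
  qed
  have nonempty: "A m \<noteq> {}" "B m \<noteq> {}" for m using common_element[of m] by auto

  \<comment> \<open>Here and in \<open>D_measurable\<close> and \<open>Y_measurable\<close>,
    \<open>N\<close> will be \<open>M\<close> or the sigma-algebra generated by one group of hash
    functions.\<close>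
  have P_measurable: "Measurable.pred N (P n j)"
    if "\<And>e. e \<in> E (Suc n) \<Longrightarrow> h (Suc n) j e \<in> borel_measurable N" for N n j
  proof -
    have [measurable]: "(\<lambda>\<omega>. Max ((\<lambda>e. h (Suc n) j e \<omega>) ` A (Suc n))) \<in> borel_measurable N"
      "(\<lambda>\<omega>. Max ((\<lambda>e. h (Suc n) j e \<omega>) ` B (Suc n))) \<in> borel_measurable N"
      using finite_sets nonempty by (auto intro!: borel_measurable_Max that simp: E_def)
    show ?thesis unfolding P_def by measurable
  qed
  have h_measurable: "h (Suc n) j e \<in> borel_measurable M" if "j \<in> {1..Suc n}" "e \<in> E (Suc n)" for n j e
  proof -
    have "\<forall>i\<in>{1..Suc n} \<times> E (Suc n). (case i of (j, e) \<Rightarrow> h (Suc n) j e) \<in> borel_measurable M"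
      using h_indep[of "Suc n"] unfolding indep_vars_def2 E_def by simp
    from bspec[OF this, of "(j, e)"] that show ?thesis by simp
  qed
  have P[measurable]: "Measurable.pred M (P n j)" if "j \<in> {1..Suc n}" for n j
    by (rule P_measurable) (rule h_measurable[OF that])

  have prob_P: "\<P>(\<omega> in M. P n j \<omega>) = \<rho>" if j: "j \<in> {1..Suc n}" for n j
  proof -
    \<comment> \<open>The hash values are jointly independent over pairs, so the sets are embedded
      at level \<open>j\<close>; this injection preserves the Jaccard similarity.\<close>
    let ?A = "Pair j ` A (Suc n)" and ?B = "Pair j ` B (Suc n)"
    have "\<P>(\<omega> in M. Max ((\<lambda>i. (case i of (j, e) \<Rightarrow> h (Suc n) j e) \<omega>) ` ?A) =
        Max ((\<lambda>i. (case i of (j, e) \<Rightarrow> h (Suc n) j e) \<omega>) ` ?B)) = jaccard ?A ?B"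
    proof (rule prob_Max_eq)
      show "finite ?A" "finite ?B" using finite_sets by auto
      show "?A \<inter> ?B \<noteq> {}" using common_element[of "Suc n"] by auto
      show "indep_vars (\<lambda>_. borel) (\<lambda>(j, e). h (Suc n) j e) (?A \<union> ?B)"
        by (rule indep_vars_subset[OF h_indep]) (use j in auto)
      show "distr M borel (case i of (j, e) \<Rightarrow> h (Suc n) j e) = uniform_measure lborel {0<..<1}"
        if "i \<in> ?A \<union> ?B" for i
        using that h_uniform[of "Suc n" j] j by auto
    qed
    also have "jaccard ?A ?B = jaccard (A (Suc n)) (B (Suc n))"
    proof -
      have "inj (Pair j :: 'e \<Rightarrow> _)" by (auto intro: injI)
      then show ?thesis
        by (simp add: jaccard_def image_Un[symmetric] image_Int[symmetric] card_image inj_on_subset)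
    qed
    finally show ?thesis by (simp add: P_def image_image similarity)
  qed

  have ind: "indep_vars (\<lambda>_. borel) (\<lambda>j \<omega>. of_bool (P n j \<omega>) :: real) {1..Suc n}" for n
  proof -
    \<comment> \<open>The blocks belonging to different \<open>j\<close> are disjoint, and each
      indicator is a function of its own block.\<close>
    let ?K = "\<lambda>j. {j} \<times> E (Suc n)"
    have "indep_vars (\<lambda>j. Pi\<^sub>M (?K j) (\<lambda>_. borel))
        (\<lambda>j \<omega>. restrict (\<lambda>i. (case i of (j, e) \<Rightarrow> h (Suc n) j e) \<omega>) (?K j)) {1..Suc n}"
      by (rule indep_vars_restrict[OF h_indep]) (auto simp: disjoint_family_on_def E_def)
    then have "indep_vars (\<lambda>_. borel)
        (\<lambda>j \<omega>. (\<lambda>f. of_bool (Max ((\<lambda>e. f (j, e)) ` A (Suc n)) = Max ((\<lambda>e. f (j, e)) ` B (Suc n))) :: real)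
          (restrict (\<lambda>i. (case i of (j, e) \<Rightarrow> h (Suc n) j e) \<omega>) (?K j))) {1..Suc n}"
    proof (rule indep_vars_compose2)
      fix j
      have "(\<lambda>f. f (j, e)) \<in> borel_measurable (Pi\<^sub>M (?K j) (\<lambda>_. borel :: real measure))"
        if "e \<in> E (Suc n)" for e
        using that by (intro measurable_component_singleton) auto
      then have Max_measurable:
        "(\<lambda>f. Max ((\<lambda>e. f (j, e)) ` A (Suc n))) \<in> borel_measurable (Pi\<^sub>M (?K j) (\<lambda>_. borel :: real measure))"
        "(\<lambda>f. Max ((\<lambda>e. f (j, e)) ` B (Suc n))) \<in> borel_measurable (Pi\<^sub>M (?K j) (\<lambda>_. borel :: real measure))"
        using finite_sets nonempty by (auto intro!: borel_measurable_Max simp: E_def)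
      have "Measurable.pred (Pi\<^sub>M (?K j) (\<lambda>_. borel :: real measure))
          (\<lambda>f. Max ((\<lambda>e. f (j, e)) ` A (Suc n)) = Max ((\<lambda>e. f (j, e)) ` B (Suc n)))"
        unfolding pred_def by (rule borel_measurable_eq[OF Max_measurable])
      then show "(\<lambda>f. of_bool (Max ((\<lambda>e. f (j, e)) ` A (Suc n)) = Max ((\<lambda>e. f (j, e)) ` B (Suc n))) :: real)
          \<in> borel_measurable (Pi\<^sub>M (?K j) (\<lambda>_. borel :: real measure))"
        by (rule measurable_compose[where g = of_bool]) simp
    qed
    moreover have "(\<lambda>e. restrict (\<lambda>i. (case i of (j, e) \<Rightarrow> h (Suc n) j e) \<omega>) (?K j) (j, e)) ` K
        = (\<lambda>e. h (Suc n) j e \<omega>) ` K" if "K \<subseteq> E (Suc n)" for j \<omega> K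
      using that by (intro image_cong) auto
    ultimately show ?thesis by (simp add: P_def E_def)
  qed

  have D_measurable: "D n \<in> borel_measurable N"
    if "\<And>j e. j \<in> {1..Suc n} \<Longrightarrow> e \<in> E (Suc n) \<Longrightarrow> h (Suc n) j e \<in> borel_measurable N" for N n
  proof -
    have [measurable]: "Measurable.pred N (P n j)" if "j \<in> {1..Suc n}" for j
      by (rule P_measurable) (rule \<open>\<And>j e. _ \<Longrightarrow> _ \<Longrightarrow> h (Suc n) j e \<in> borel_measurable N\<close>[OF that])
    show ?thesis unfolding D_def by measurable
  qed
  have Y_measurable: "Y n \<in> borel_measurable N"
    if "\<And>e. e \<in> E (Suc n) \<Longrightarrow> g1 (Suc n) e \<in> borel_measurable N"
      "\<And>e. e \<in> E (Suc n) \<Longrightarrow> g2 (Suc n) e \<in> N \<rightarrow>\<^sub>M count_space UNIV" for N n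
  proof -
    have [measurable]: "H (Suc n) \<in> borel_measurable N"
      unfolding H_def by (rule measurable_hll_estimate) (use that stream in \<open>auto simp: E_def\<close>)
    show ?thesis unfolding Y_def by measurable
  qed
  have D[measurable]: "D n \<in> borel_measurable M" for n
    by (rule D_measurable) (rule h_measurable)
  have Y[measurable]: "Y n \<in> borel_measurable M" for n
    by (rule Y_measurable) (auto simp: E_def intro: g1_measurable g2_measurable)
  have Z[measurable]: "Z n \<in> borel_measurable M" for n
    unfolding Z_def by measurable

  \<comment> \<open>\<open>D n\<close> is measurable for the sigma-algebra generated by the
    \<open>h\<close> values and \<open>Y n\<close> for that generated by the pairs of
    \<open>g1\<close> and \<open>g2\<close> values.\<close>
  have indep_DY: "indep_var borel (D n) borel (Y n)" for n
  proof (rule indep_var_if_indep_set[OF hg_indep[of "Suc n"]])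
    let ?I = "{1..Suc n} \<times> (A (Suc n) \<union> B (Suc n))"
    let ?F = "\<lambda>\<omega>. \<lambda>(j, e)\<in>?I. h (Suc n) j e \<omega>"
    let ?N = "vimage_algebra (space M) ?F (Pi\<^sub>M ?I (\<lambda>_. borel))"
    show "D n \<in> borel_measurable ?N"
    proof (rule D_measurable)
      fix j e assume je: "j \<in> {1..Suc n}" "e \<in> E (Suc n)"
      have "?F \<in> ?N \<rightarrow>\<^sub>M Pi\<^sub>M ?I (\<lambda>_. borel)"
        by (rule measurable_vimage_algebra1) (auto simp: space_PiM)
      from measurable_compose[OF this measurable_component_singleton[of "(j, e)"]] je
      show "h (Suc n) j e \<in> borel_measurable ?N" by (simp add: E_def)
    qed
    let ?G = "\<lambda>\<omega>. \<lambda>e\<in>A (Suc n) \<union> B (Suc n). (g1 (Suc n) e \<omega>, g2 (Suc n) e \<omega>)"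
    let ?L = "vimage_algebra (space M) ?G (Pi\<^sub>M (A (Suc n) \<union> B (Suc n)) (\<lambda>_. borel \<Otimes>\<^sub>M count_space UNIV))"
    have "?G \<in> ?L \<rightarrow>\<^sub>M Pi\<^sub>M (A (Suc n) \<union> B (Suc n)) (\<lambda>_. borel \<Otimes>\<^sub>M count_space UNIV)"
      by (rule measurable_vimage_algebra1) (auto simp: space_PiM space_pair_measure)
    note G = measurable_compose[OF this measurable_component_singleton]
    show "Y n \<in> borel_measurable ?L"
    proof (rule Y_measurable)
      fix e assume e: "e \<in> E (Suc n)"
      show "g1 (Suc n) e \<in> borel_measurable ?L"
        using measurable_compose[OF G[of e] measurable_fst] e by (simp add: E_def)
      show "g2 (Suc n) e \<in> ?L \<rightarrow>\<^sub>M count_space UNIV"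
        using measurable_compose[OF G[of e] measurable_snd] e by (simp add: E_def)
    qed
  qed simp_all

  have Y_conv: "weak_conv_m (\<lambda>n. distr M borel (Y n)) std_normal_distribution"
  proof -
    have "Y n = (\<lambda>\<omega>. (hll_estimate (Suc n) (\<lambda>e. g1 (Suc n) e \<omega>) (\<lambda>e. g2 (Suc n) e \<omega>) (S (Suc n))
        - real (card (A (Suc n) \<union> B (Suc n)))) / sqrt ((real (card (A (Suc n) \<union> B (Suc n))))\<^sup>2 / real (Suc n)))" for n
      by (rule ext) (simp only: Y_def H_def u_def E_def)
    then show ?thesis
      using hll_performance[unfolded asymptotically_normal_def, THEN weak_conv_m_Suc_iff[THEN iffD2]]
      by (simp only:)
  qed
  have Y_char: "(\<lambda>n. char (distr M borel (Y n)) t) \<longlonglongrightarrow> complex_of_real (exp (- (t\<^sup>2) / 2))" for t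
    using levy_continuity1[OF _ real_dist_normal_dist Y_conv, of t]
    by (simp add: char_std_normal_distribution)
  \<comment> \<open>The limit is the characteristic function of variance \<open>1 - \<rho>\<close>,
    left in unsimplified form.\<close>
  have D_char: "(\<lambda>n. char (distr M borel (D n)) t)
      \<longlonglongrightarrow> complex_of_real (exp (- (t\<^sup>2 / \<rho> * (\<rho> * (1 - \<rho>)) / 2)))" for t
    unfolding D_def by (rule char_sum_of_bool_tendsto[OF P prob_P ind \<rho>])
  have W_char: "(\<lambda>n. char (distr M borel (\<lambda>\<omega>. D n \<omega> + sqrt \<rho> * Y n \<omega>)) t)
      \<longlonglongrightarrow> char std_normal_distribution t" for t
  proof -
    have "indep_var borel (D n) borel (\<lambda>\<omega>. sqrt \<rho> * Y n \<omega>)" for n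
      using indep_var_compose[OF indep_DY, of "\<lambda>x. x" borel "\<lambda>y. sqrt \<rho> * y" borel n] by (simp add: comp_def)
    then have eq: "char (distr M borel (\<lambda>\<omega>. D n \<omega> + sqrt \<rho> * Y n \<omega>)) t =
        char (distr M borel (D n)) t * char (distr M borel (Y n)) (sqrt \<rho> * t)" for n
      by (simp add: char_distr_add char_distr_scale)
    have "- (t\<^sup>2 / \<rho> * (\<rho> * (1 - \<rho>)) / 2) + - ((sqrt \<rho> * t)\<^sup>2) / 2 = - (t\<^sup>2) / 2"
      using \<rho> by (simp add: power_mult_distrib field_simps)
    then have "complex_of_real (exp (- (t\<^sup>2 / \<rho> * (\<rho> * (1 - \<rho>)) / 2))) * complex_of_real (exp (- ((sqrt \<rho> * t)\<^sup>2) / 2))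
        = char std_normal_distribution t"
      by (simp only: char_std_normal_distribution of_real_mult[symmetric] exp_add[symmetric])
    with tendsto_mult[OF D_char[of t] Y_char[of "sqrt \<rho> * t"]] show ?thesis by (simp only: eq)
  qed
  have Z_null: "(\<lambda>n. prob {\<omega> \<in> space M. \<epsilon> \<le> \<bar>Z n \<omega>\<bar>}) \<longlonglongrightarrow> 0" if \<epsilon>: "\<epsilon> > 0" for \<epsilon>
  proof -
    have "Z n \<omega> = (\<Sum>j=1..Suc n. of_bool (P n j \<omega>) - \<rho>) / real (Suc n) / sqrt \<rho>" for n \<omega>
      by (simp add: Z_def D_def real_sqrt_mult mult_ac del: sum.cl_ivl_Suc of_nat_Suc)
    then have "\<epsilon> \<le> \<bar>Z n \<omega>\<bar> \<longleftrightarrow> \<epsilon> * sqrt \<rho> \<le> \<bar>(\<Sum>j=1..Suc n. of_bool (P n j \<omega>) - \<rho>) / real (Suc n)\<bar>" for n \<omega>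
      using \<rho> by (simp only: abs_divide[of _ "sqrt \<rho>"]) (simp add: pos_le_divide_eq mult_ac del: sum.cl_ivl_Suc of_nat_Suc)
    then show ?thesis
      using prob_mean_of_bool_null[OF P prob_P ind, of "\<epsilon> * sqrt \<rho>"] \<epsilon> \<rho> by simp
  qed
  \<comment> \<open>The Jaccard estimate over \<open>\<rho>\<close> is
    \<open>1 + Z / sqrt \<rho>\<close> and the HyperLogLog estimate over \<open>u\<close> is
    \<open>1 + Y / sqrt m\<close>. Multiplying out, subtracting 1 and scaling by
    \<open>sqrt (m * \<rho>)\<close> leaves the three summands.\<close>
  have decomp: "(scheme2_estimate (Suc n) (\<lambda>j e. h (Suc n) j e \<omega>) (\<lambda>e. g1 (Suc n) e \<omega>) (\<lambda>e. g2 (Suc n) e \<omega>)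
        (A (Suc n)) (B (Suc n)) (S (Suc n)) / real (card (A (Suc n) \<inter> B (Suc n))) - 1)
        / sqrt (1 / (real (Suc n) * \<rho>))
      = D n \<omega> + sqrt \<rho> * Y n \<omega> + Z n \<omega> * Y n \<omega>" for n \<omega>
  proof -
    define m where "m = real (Suc n)"
    define s where "s = (\<Sum>j=1..Suc n. of_bool (P n j \<omega>) :: real)"
    have m: "m > 0" by (simp add: m_def)
    \<comment> \<open>Writing \<open>m\<close> and \<open>\<rho>\<close> as squares turns the claim
      into an identity of rational functions.\<close>
    define a b where "a = sqrt m" and "b = sqrt \<rho>"
    have ab: "a > 0" "b > 0" "m = a * a" "\<rho> = b * b" using m \<rho> by (auto simp: a_def b_def)
    have D_eq: "D n \<omega> = (s - m * \<rho>) / (a * b)"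
      by (simp add: D_def s_def m_def a_def b_def sum_subtractf real_sqrt_mult del: sum.cl_ivl_Suc of_nat_Suc)
    have Y_eq: "Y n \<omega> = (H (Suc n) \<omega> - u (Suc n)) * a / u (Suc n)"
      using u_pos[of "Suc n"] by (simp add: Y_def m_def a_def real_sqrt_divide del: of_nat_Suc)
    have Z_eq: "Z n \<omega> = D n \<omega> / a" by (simp add: Z_def m_def a_def)
    have "scheme2_estimate (Suc n) (\<lambda>j e. h (Suc n) j e \<omega>) (\<lambda>e. g1 (Suc n) e \<omega>) (\<lambda>e. g2 (Suc n) e \<omega>)
        (A (Suc n)) (B (Suc n)) (S (Suc n)) = s / m * H (Suc n) \<omega>"
      by (simp add: scheme2_estimate_def jaccard_estimate_def s_def m_def H_def P_def del: sum.cl_ivl_Suc of_nat_Suc)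
    moreover have "sqrt (1 / (real (Suc n) * \<rho>)) = 1 / (a * b)"
      by (simp add: a_def b_def m_def real_sqrt_divide real_sqrt_mult del: of_nat_Suc)
    moreover have "(s / m * H (Suc n) \<omega> / (\<rho> * u (Suc n)) - 1) / (1 / (a * b))
        = D n \<omega> + b * Y n \<omega> + Z n \<omega> * Y n \<omega>"
      unfolding Z_eq unfolding D_eq Y_eq ab(3,4) using ab(1,2) u_pos[of "Suc n"] by (simp add: field_simps)
    ultimately show ?thesis by (simp add: card_inter b_def)
  qed
  have "weak_conv_m (\<lambda>n. distr M borel (\<lambda>\<omega>. D n \<omega> + sqrt \<rho> * Y n \<omega> + Z n \<omega> * Y n \<omega>)) std_normal_distribution"
  proof (rule levy_continuity)
    show "(\<lambda>n. char (distr M borel (\<lambda>\<omega>. D n \<omega> + sqrt \<rho> * Y n \<omega> + Z n \<omega> * Y n \<omega>)) t)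
        \<longlonglongrightarrow> char std_normal_distribution t" for t
    proof (rule char_add_null[OF _ _ _ W_char])
      show "(\<lambda>n. prob {\<omega> \<in> space M. \<epsilon> < \<bar>Z n \<omega> * Y n \<omega>\<bar>}) \<longlonglongrightarrow> 0" if "\<epsilon> > 0" for \<epsilon>
        by (rule prob_mult_null[OF Z Y Z_null Y_conv real_dist_normal_dist isCont_cdf_std_normal that])
    qed measurable
  qed (auto intro!: real_distribution_distr real_dist_normal_dist)
  then show ?thesis
    unfolding asymptotically_normal_def by (subst weak_conv_m_Suc_iff[symmetric]) (simp only: decomp)
qed

end
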